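(* There is no $5$-by-$24$ shorthand universal torus for the permutations of $\{0,1,2,3,4\}$ with $2$-by-$2$ windows.
   Context: A $5$-by-$24$ shorthand universal torus for the permutations of $\{0,1,2,3,4\}$ with $2$-by-$2$ windows is an array $T : \mathbb{Z}_5 \times \mathbb{Z}_{24} \to \{0,1,2,3,4\}$ (row indices modulo $5$, column indices modulo $24$) such that every word of length $4$ with pairwise distinct entries in $\{0,1,2,3,4\}$ is equal to the row-major reading $T(i,j)\,T(i,j+1)\,T(i+1,j)\,T(i+1,j+1)$ for exactly one position $(i,j)\in \mathbb{Z}_5\times\mathbb{Z}_{24}$. (Each such word encodes a permutation of five symbols by appending its missing symbol.) *)

theory Defs
  imports Main "HOL-Library.Numeral_Type"
begin

text \<open>
  The numeral types \<open>5\<close> and \<open>24\<close> are the rings of integers modulo 5 and 24,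
  so \<open>i + 1\<close> and \<open>j + 1\<close> below wrap around.
\<close>

definition window :: "(5 \<Rightarrow> 24 \<Rightarrow> nat) \<Rightarrow> 5 \<Rightarrow> 24 \<Rightarrow> nat list" where
  "window T i j = [T i j, T i (j + 1), T (i + 1) j, T (i + 1) (j + 1)]"

definition shorthand_universal_torus :: "(5 \<Rightarrow> 24 \<Rightarrow> nat) \<Rightarrow> bool" where
  "shorthand_universal_torus T \<longleftrightarrow>
     (\<forall>i j. T i j \<in> {0, 1, 2, 3, 4}) \<and>
     (\<forall>w. length w = 4 \<and> distinct w \<and> set w \<subseteq> {0, 1, 2, 3, 4} \<longrightarrow>
        (\<exists>!p. window T (fst p) (snd p) = w))"

end

theory Submission
  imports Defs
begin

text \<open>
  There are 120 positions and 120 words, so every window has four distinct entries. Hence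
  in two adjacent columns each symbol occurs at most twice, and, as these columns have ten
  cells, exactly twice. If some column contains a symbol \<open>a\<close> twice and a symbol \<open>b\<close> not at all,
  then the two alternate, so \<open>a\<close> and \<open>b\<close> never share a column and \<open>a\<close> never stands
  directly above \<open>b\<close>, contradicting universality. Otherwise every column is a
  permutation, in which each symbol sits two rows above or below its place in the previous
  column. Injectivity forces all symbols to move in the same direction, so the columns are
  cyclic rotations of each other and only five of the twenty vertical pairs occur.
\<close>

lemma UNIV_5: "(UNIV :: 5 set) = {0, 1, 2, 3, 4}"
proof -
  have "card {0, 1, 2, 3, 4 :: 5} = CARD(5)"
    by simp
  then show ?thesis
    by (metis card_subset_eq finite subset_UNIV)
qed

lemma cyclic_induct_5:
  assumes "P 0" and step: "\<And>i :: 5. P i \<Longrightarrow> P (i + 1)"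
  shows "P i"
proof -
  have "P 1" using step[OF \<open>P 0\<close>] by simp
  have "P 2" using step[OF \<open>P 1\<close>] by simp
  have "P 3" using step[OF \<open>P 2\<close>] by simp
  have "P 4" using step[OF \<open>P 3\<close>] by simp
  have "i \<in> {0, 1, 2, 3, 4}"
    using UNIV_5 by blast
  then show ?thesis
    using \<open>P 0\<close> \<open>P 1\<close> \<open>P 2\<close> \<open>P 3\<close> \<open>P 4\<close> by auto
qed

lemma cyclic_induct_24:
  assumes "P 0" and step: "\<And>j :: 24. P j \<Longrightarrow> P (j + 1)"
  shows "P j"
proof -
  have "P (of_nat k)" for k
  proof (induction k)
    case (Suc k)
    then show ?case
      using step[of "of_nat k"] by (simp add: add.commute)
  qed (simp add: \<open>P 0\<close>)
  \<comment> \<open>Every residue is the image of a nonnegative integer, so ordinary induction on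
    naturals reaches all of them.\<close>
  moreover obtain z where "j = of_int z" "0 \<le> z"
    by (cases j rule: bit0_cases) auto
  ultimately show ?thesis
    by (metis of_int_of_nat_eq zero_le_imp_eq_int)
qed

lemma torus_entry:
  assumes "shorthand_universal_torus T"
  shows "T i j \<in> {0, 1, 2, 3, 4}"
  using assms by (simp add: shorthand_universal_torus_def)

lemma distinct_window:
  assumes T: "shorthand_universal_torus T"
  shows "distinct (window T i j)"
proof -
  let ?W = "{w. length w = 4 \<and> distinct w \<and> set w \<subseteq> {0, 1, 2, 3, 4 :: nat}}"
  let ?f = "\<lambda>p. window T (fst p) (snd p)"
  have "card ?W = 120"
    using card_lists_distinct_length_eq[of "{0, 1, 2, 3, 4 :: nat}" 4]
    by (simp add: numeral_eq_Suc)
  moreover have "?W \<subseteq> range ?f"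
  proof
    fix w assume "w \<in> ?W"
    then have "\<exists>!p. ?f p = w"
      using T by (auto simp: shorthand_universal_torus_def)
    then show "w \<in> range ?f" by blast
  qed
  moreover have "card (range ?f) \<le> 120"
    using card_image_le[of UNIV ?f] by (simp add: card_prod)
  ultimately have "?W = range ?f"
    by (intro card_seteq) auto
  moreover have "window T i j \<in> range ?f"
    using rangeI[of ?f "(i, j)"] by simp
  ultimately have "window T i j \<in> ?W"
    by simp
  then show ?thesis by simp
qed

text \<open>Row-major reading puts the third letter below the first, so a window reading
  \<open>[a, c, b, d]\<close> suffices, with \<open>c\<close> and \<open>d\<close> any two of the
  three remaining symbols.\<close>

lemma vertical_pair_exists:
  assumes T: "shorthand_universal_torus T"
    and ab: "a \<in> {0, 1, 2, 3, 4}" "b \<in> {0, 1, 2, 3, 4}" "a \<noteq> b"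
  shows "\<exists>i j. T i j = a \<and> T (i + 1) j = b"
proof -
  have "card ({0, 1, 2, 3, 4} - {a, b}) = 3"
    using ab by (subst card_Diff_subset) auto
  then obtain c d e where "{0, 1, 2, 3, 4} - {a, b} = {c, d, e}" "c \<noteq> d"
    by (metis card_3_iff)
  then have "c \<in> {0, 1, 2, 3, 4} - {a, b}" "d \<in> {0, 1, 2, 3, 4} - {a, b}"
    by simp_all
  with ab \<open>c \<noteq> d\<close> have "length [a, c, b, d] = 4 \<and> distinct [a, c, b, d] \<and>
      set [a, c, b, d] \<subseteq> {0, 1, 2, 3, 4}"
    by auto
  then obtain p where "window T (fst p) (snd p) = [a, c, b, d]"
    using T unfolding shorthand_universal_torus_def by blast
  then show ?thesis
    by (auto simp: window_def)
qed

definition occurrences :: "(5 \<Rightarrow> 24 \<Rightarrow> nat) \<Rightarrow> nat \<Rightarrow> 24 \<Rightarrow> nat" where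
  "occurrences T c j = card {i. T i j = c}"

lemma occurrences_eq_sum: "occurrences T c j = (\<Sum>i\<in>UNIV. of_bool (T i j = c))"
  by (simp add: occurrences_def)

lemma sum_occurrences:
  assumes T: "shorthand_universal_torus T"
  shows "(\<Sum>c\<in>{0, 1, 2, 3, 4}. occurrences T c j) = 5"
proof -
  have "(\<Sum>c\<in>{0, 1, 2, 3, 4}. occurrences T c j) =
      (\<Sum>i\<in>UNIV. \<Sum>c\<in>{0, 1, 2, 3, 4}. of_bool (T i j = c))"
    unfolding occurrences_eq_sum by (rule sum.swap)
  also have "\<dots> = (\<Sum>i\<in>(UNIV :: 5 set). 1)"
    by (rule sum.cong) (use torus_entry[OF T] in \<open>fastforce simp: of_bool_def\<close>)+
  finally show ?thesis by simp
qed

lemma sum_shift_5: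
  fixes f :: "5 \<Rightarrow> nat"
  shows "(\<Sum>i\<in>UNIV. f (i + 1)) = sum f UNIV"
  by (rule sum.reindex_bij_witness[of _ "\<lambda>i. i - 1" "\<lambda>i. i + 1"]) auto

lemma occurrences_adjacent_le:
  assumes "\<And>i. distinct (window T i j)"
  shows "occurrences T c j + occurrences T c (j + 1) \<le> 2"
proof -
  let ?n = "\<lambda>i j. of_bool (T i j = c) :: nat"
  \<comment> \<open>Double counting: each cell of the two columns lies in exactly two of the five
    windows spanning them, and each window contains \<open>c\<close> at most once. So twice the
    count is at most 5, and integrality brings the count down to 2.\<close>
  have "2 * (occurrences T c j + occurrences T c (j + 1)) =
      (\<Sum>i\<in>UNIV. ?n i j + ?n i (j + 1) + ?n (i + 1) j + ?n (i + 1) (j + 1))"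
    unfolding sum.distrib occurrences_eq_sum
    using sum_shift_5[of "\<lambda>i. ?n i j"] sum_shift_5[of "\<lambda>i. ?n i (j + 1)"] by simp
  also have "\<dots> \<le> (\<Sum>i\<in>(UNIV :: 5 set). 1)"
  proof (rule sum_mono)
    show "?n i j + ?n i (j + 1) + ?n (i + 1) j + ?n (i + 1) (j + 1) \<le> 1" for i
      using assms[of i] by (auto simp: window_def of_bool_def)
  qed
  finally show ?thesis by simp
qed

lemma occurrences_adjacent:
  assumes T: "shorthand_universal_torus T" and c: "c \<in> {0, 1, 2, 3, 4}"
  shows "occurrences T c j + occurrences T c (j + 1) = 2"
proof -
  let ?s = "\<lambda>c. occurrences T c j + occurrences T c (j + 1)"
  have le: "?s c \<le> 2" for c
    by (rule occurrences_adjacent_le) (rule distinct_window[OF T])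
  have "(\<Sum>c\<in>{0, 1, 2, 3, 4}. ?s c) = 10"
    unfolding sum.distrib sum_occurrences[OF T] by simp
  then show ?thesis
    using c le[of 0] le[of 1] le[of 2] le[of 3] le[of 4] by auto
qed

lemma occurrences_not_two_zero:
  assumes T: "shorthand_universal_torus T"
    and ab: "a \<in> {0, 1, 2, 3, 4}" "b \<in> {0, 1, 2, 3, 4}"
    and a2: "occurrences T a 0 = 2" and b0: "occurrences T b 0 = 0"
  shows False
proof -
  \<comment> \<open>This disjunction is invariant: adjacent counts of a symbol add up to 2, so each
    step to the right exchanges the counts 2 and 0.\<close>
  let ?P = "\<lambda>j. (occurrences T a j = 2 \<and> occurrences T b j = 0) \<or>
    (occurrences T a j = 0 \<and> occurrences T b j = 2)"
  have P: "?P j" for j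
  proof (induction j rule: cyclic_induct_24)
    case 1
    show ?case using a2 b0 by simp
  next
    case (2 j)
    then show ?case
      using occurrences_adjacent[OF T ab(1), of j] occurrences_adjacent[OF T ab(2), of j] by auto
  qed
  have "a \<noteq> b" using a2 b0 by auto
  then obtain i j where "T i j = a" "T (i + 1) j = b"
    using vertical_pair_exists[OF T ab] by blast
  then have "occurrences T a j \<noteq> 0" "occurrences T b j \<noteq> 0"
    by (auto simp: occurrences_def)
  with P[of j] show False by auto
qed

lemma occurrences_one:
  assumes T: "shorthand_universal_torus T" and c: "c \<in> {0, 1, 2, 3, 4}"
  shows "occurrences T c j = 1"
proof (induction j rule: cyclic_induct_24)
  case 1
  have le: "occurrences T c 0 \<le> 2" for c
    using occurrences_adjacent_le[OF distinct_window[OF T], of c 0] by simp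
  note s = sum_occurrences[OF T, of 0]
  show ?case
  proof (rule ccontr)
    assume c1: "occurrences T c 0 \<noteq> 1"
    \<comment> \<open>The five counts of column 0 add up to 5, so their average is 1. If none were
      2, or none were 0, all would be 1.\<close>
    have "\<exists>a\<in>{0, 1, 2, 3, 4}. occurrences T a 0 = 2"
    proof (rule ccontr)
      assume "\<not> ?thesis"
      then have "\<forall>a\<in>{0, 1, 2, 3, 4}. occurrences T a 0 \<le> 1"
        using le by (metis One_nat_def le_SucE numeral_2_eq_2)
      with s c c1 show False by auto
    qed
    moreover have "\<exists>b\<in>{0, 1, 2, 3, 4}. occurrences T b 0 = 0"
    proof (rule ccontr)
      assume "\<not> ?thesis"
      then have "\<forall>a\<in>{0, 1, 2, 3, 4}. occurrences T a 0 \<ge> 1"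
        by (metis One_nat_def Suc_leI neq0_conv)
      with s c c1 show False by auto
    qed
    ultimately show False
      using occurrences_not_two_zero[OF T] by blast
  qed
next
  case (2 j)
  then show ?case
    using occurrences_adjacent[OF T c, of j] by simp
qed

lemma inj_column:
  assumes T: "shorthand_universal_torus T"
  shows "inj (\<lambda>i. T i j)"
proof (rule injI)
  fix i i' assume eq: "T i j = T i' j"
  obtain k where k: "{l. T l j = T i' j} = {k}"
    using occurrences_one[OF T torus_entry[OF T, of i' j], of j]
    unfolding occurrences_def by (metis card_1_singletonE)
  have "i \<in> {l. T l j = T i' j}" "i' \<in> {l. T l j = T i' j}"
    using eq by simp_all
  with k show "i = i'" by simp
qed

lemma next_column_rotation:
  assumes T: "shorthand_universal_torus T"
  shows "\<exists>s. \<forall>i. T i (j + 1) = T (i + s) j"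
proof -
  have range: "range (\<lambda>i. T i j) = {0, 1, 2, 3, 4}" for j
  proof (rule card_seteq)
    show "card {0, 1, 2, 3, 4 :: nat} \<le> card (range (\<lambda>i. T i j))"
      using card_image[OF inj_column[OF T, of j]] by simp
    show "range (\<lambda>i. T i j) \<subseteq> {0, 1, 2, 3, 4}"
      by (intro image_subsetI torus_entry[OF T])
  qed simp
  \<comment> \<open>In column \<open>j\<close>, rows \<open>i\<close> and \<open>i + 1\<close> share
    the window at row \<open>i\<close> with the cell \<open>(i, j + 1)\<close>, and row
    \<open>i + 4\<close>, which is \<open>i - 1\<close>, shares the window above. Only the offsets 2
    and 3 remain.\<close>
  have *: "T i (j + 1) = T (i + 2) j \<or> T i (j + 1) = T (i + 3) j" for i
  proof -
    have "T i (j + 1) \<in> range (\<lambda>k. T k j)"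
      unfolding range by (rule torus_entry[OF T])
    then obtain k where k: "T i (j + 1) = T k j" by blast
    have "k - i \<in> {0, 1, 2, 3, 4}"
      using UNIV_5 by blast
    moreover have "k - i \<noteq> 0" "k - i \<noteq> 1"
      using distinct_window[OF T, of i j] k by (auto simp: window_def algebra_simps)
    moreover have "k - i \<noteq> 4"
    proof
      assume "k - i = 4"
      then have "k + 1 = i" by (simp add: algebra_simps)
      then show False
        using distinct_window[OF T, of k j] k by (auto simp: window_def)
    qed
    ultimately have "k = i + 2 \<or> k = i + 3"
      by (auto simp: algebra_simps)
    with k show ?thesis by auto
  qed
  \<comment> \<open>Offset 2 in row \<open>i + 1\<close> would point to row \<open>i + 3\<close> of
    column \<open>j\<close>, whose symbol row \<open>i\<close> of column \<open>j + 1\<close> has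
    already taken. So a single offset 3 propagates around the whole column; without one, all offsets
    are 2.\<close>
  have step: "T (i + 1) (j + 1) = T (i + 1 + 3) j" if "T i (j + 1) = T (i + 3) j" for i
  proof -
    have "T (i + 1) (j + 1) \<noteq> T i (j + 1)"
      using injD[OF inj_column[OF T, of "j + 1"], of "i + 1" i] by auto
    moreover have "i + 1 + 2 = i + 3"
      by simp
    ultimately show ?thesis
      using *[of "i + 1"] that by metis
  qed
  show ?thesis
  proof (cases "\<exists>i. T i (j + 1) = T (i + 3) j")
    case True
    then obtain i where i: "T i (j + 1) = T (i + 3) j" by blast
    have "T (i + k) (j + 1) = T (i + k + 3) j" for k
    proof (induction k rule: cyclic_induct_5)
      case 1
      show ?case using i by simp
    next
      case (2 k)
      then show ?case using step[of "i + k"] by (simp only: add.assoc)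
    qed
    from this[of "i' - i" for i'] have "T i' (j + 1) = T (i' + 3) j" for i'
      by simp
    then show ?thesis by blast
  next
    case False
    with * show ?thesis by metis
  qed
qed

theorem theorem3: "\<not> (\<exists>T. shorthand_universal_torus T)"
proof
  assume "\<exists>T. shorthand_universal_torus T"
  then obtain T where T: "shorthand_universal_torus T" by blast
  have rotation: "\<exists>s. \<forall>i. T i j = T (i + s) 0" for j
  proof (induction j rule: cyclic_induct_24)
    case 1
    show ?case by (rule exI[of _ 0]) simp
  next
    case (2 j)
    then show ?case
      using next_column_rotation[OF T, of j] by (metis add.assoc)
  qed
  have inj: "T i 0 = T k 0 \<longleftrightarrow> i = k" for i k
    using inj_column[OF T] by (auto dest: injD)
  \<comment> \<open>In every rotation of column 0, the symbol directly below \<open>T 0 0\<close> is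
    \<open>T 1 0\<close>, so the pair of \<open>T 0 0\<close> above \<open>T 2 0\<close> is
    missing.\<close>
  have "T 0 0 \<noteq> T 2 0"
    by (simp add: inj)
  then obtain i j where ij: "T i j = T 0 0" "T (i + 1) j = T 2 0"
    using vertical_pair_exists[OF T torus_entry[OF T] torus_entry[OF T]] by blast
  obtain s where "\<forall>i. T i j = T (i + s) 0"
    using rotation by blast
  with ij have "i + s = 0" "i + 1 + s = 2"
    by (simp_all add: inj)
  then have "(1 :: 5) = 2"
    by (metis add.commute add.left_commute add.right_neutral)
  then show False by simp
qed

end
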